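(* Let $\mathcal{M}$ be a structure satisfying the strong Erd\H{o}s--Hajnal property. Then for every formula $\varphi(x,y;z)$ with $|x|=|y|$ there is some $c=c(\varphi)$ such that $R^*_\varphi(n)\le n^c$ for all $n$ large enough.
   Context: "Formula" means a formula in the language of $\mathcal{M}$; $M$ is the underlying set of $\mathcal{M}$. Strong Erd\H{o}s--Hajnal (EH) property. Let $\mathcal{G}$ be a class of finite binary relations, i.e. of triples $(E,V_1,V_2)$ with $V_1,V_2$ finite sets (not necessarily disjoint) and $E\subseteq V_1\times V_2$. $\mathcal{G}$ has the strong EH property if there is $\delta>0$ such that for every $(E,V_1,V_2)\in\mathcal{G}$ there are subsets $V_i'\subseteq V_i$ with $|V_i'|\ge\delta|V_i|$ for $i=1,2$ such that either $V_1'\times V_2'\subseteq E$ or $(V_1'\times V_2')\cap E=\emptyset$. For a formula $\varphi(x_1,x_2;z)$ with $|x_1|=|x_2|=d$, let $\mathcal{G}_\varphi$ be the family of all triples $(E,V_1,V_2)$ with $V_1,V_2\subseteq M^d$ finite and $E=\{(a_1,a_2)\in V_1\times V_2:\mathcal{M}\models\varphi(a_1,a_2;b)\}$ for some $b\in M^{|z|}$. The structure $\mathcal{M}$ satisfies the strong EH property if $\mathcal{G}_\varphi$ has the strong EH property for every such formula $\varphi$ (with $\delta$ allowed to depend on $\varphi$). For a binary relation $E\subseteq X^2$, a finite sequence $(a_i:1\le i\le m)$ in $X$ is $E$-indiscernible if either $E$ holds on all pairs $(a_i,a_j)$ with $1\le i<j\le m$, or $E$ fails on all such pairs. For a formula $\varphi(x,y;z)$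 with $|x|=|y|=d$ and $b\in M^{|z|}$, let $R_{\varphi(x,y;b)}(n)$ be the smallest $N\in\mathbb{N}$ such that every sequence of length $N$ of elements of $M^d$ contains a subsequence of length $n$ that is indiscernible for the binary relation on $M^d$ defined by $\varphi(x,y;b)$. Then $R^*_\varphi(n):=\max\{R_{\varphi(x,y;b)}(n): b\in M^{|z|}\}$. *)

theory Defs
  imports Complex_Main "HOL-Library.NList" "HOL-Library.Sublist" "HOL-Library.Ramsey"
begin

section \<open>First-order languages, formulas and structures\<close>

text \<open>
  A language is given by sets of function and relation symbols, either of which may be empty,
  together with arities. Constants are function symbols of arity 0.
\<close>

record ('f, 'r) language =
  fun_syms :: "'f set"
  rel_syms :: "'r set"
  fun_arity :: "'f \<Rightarrow> nat"
  rel_arity :: "'r \<Rightarrow> nat"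

datatype 'f tm = Var nat | Fn 'f "'f tm list"

datatype ('f, 'r) fm =
    Eq "'f tm" "'f tm"
  | Rel 'r "'f tm list"
  | Neg "('f, 'r) fm"
  | And "('f, 'r) fm" "('f, 'r) fm"
  | Ex nat "('f, 'r) fm"

fun is_term :: "('f, 'r) language \<Rightarrow> 'f tm \<Rightarrow> bool" where
  "is_term L (Var n) = True"
| "is_term L (Fn f ts) =
     (f \<in> fun_syms L \<and> length ts = fun_arity L f \<and> (\<forall>t\<in>set ts. is_term L t))"

fun is_formula :: "('f, 'r) language \<Rightarrow> ('f, 'r) fm \<Rightarrow> bool" where
  "is_formula L (Eq s t) = (is_term L s \<and> is_term L t)"
| "is_formula L (Rel r ts) =
     (r \<in> rel_syms L \<and> length ts = rel_arity L r \<and> (\<forall>t\<in>set ts. is_term L t))"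
| "is_formula L (Neg \<phi>) = is_formula L \<phi>"
| "is_formula L (And \<phi> \<psi>) = (is_formula L \<phi> \<and> is_formula L \<psi>)"
| "is_formula L (Ex n \<phi>) = is_formula L \<phi>"

fun tm_vars :: "'f tm \<Rightarrow> nat set" where
  "tm_vars (Var n) = {n}"
| "tm_vars (Fn f ts) = (\<Union>t\<in>set ts. tm_vars t)"

fun free_vars :: "('f, 'r) fm \<Rightarrow> nat set" where
  "free_vars (Eq s t) = tm_vars s \<union> tm_vars t"
| "free_vars (Rel r ts) = (\<Union>t\<in>set ts. tm_vars t)"
| "free_vars (Neg \<phi>) = free_vars \<phi>"
| "free_vars (And \<phi> \<psi>) = free_vars \<phi> \<union> free_vars \<psi>"
| "free_vars (Ex n \<phi>) = free_vars \<phi> - {n}"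

record ('f, 'r, 'a) fo_structure =
  univ :: "'a set"
  fun_int :: "'f \<Rightarrow> 'a list \<Rightarrow> 'a"
  rel_int :: "'r \<Rightarrow> 'a list \<Rightarrow> bool"

definition is_structure :: "('f, 'r) language \<Rightarrow> ('f, 'r, 'a) fo_structure \<Rightarrow> bool" where
  "is_structure L M \<longleftrightarrow> univ M \<noteq> {} \<and>
     (\<forall>f\<in>fun_syms L. \<forall>as\<in>nlists (fun_arity L f) (univ M). fun_int M f as \<in> univ M)"

fun tm_val :: "('f, 'r, 'a) fo_structure \<Rightarrow> (nat \<Rightarrow> 'a) \<Rightarrow> 'f tm \<Rightarrow> 'a" where
  "tm_val M e (Var n) = e n"
| "tm_val M e (Fn f ts) = fun_int M f (map (tm_val M e) ts)"

fun sat :: "('f, 'r, 'a) fo_structure \<Rightarrow> (nat \<Rightarrow> 'a) \<Rightarrow> ('f, 'r) fm \<Rightarrow> bool" where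
  "sat M e (Eq s t) = (tm_val M e s = tm_val M e t)"
| "sat M e (Rel r ts) = rel_int M r (map (tm_val M e) ts)"
| "sat M e (Neg \<phi>) = (\<not> sat M e \<phi>)"
| "sat M e (And \<phi> \<psi>) = (sat M e \<phi> \<and> sat M e \<psi>)"
| "sat M e (Ex n \<phi>) = (\<exists>a\<in>univ M. sat M (e(n := a)) \<phi>)"

text \<open>
  A formula \<open>\<phi>(x,y;z)\<close> with \<open>|x| = |y|\<close> is a formula together with tuples \<open>x\<close>, \<open>y\<close>, \<open>z\<close> of pairwise
  distinct variables which include all its free variables.
\<close>

definition partitioned_formula ::
  "('f, 'r) language \<Rightarrow> ('f, 'r) fm \<Rightarrow> nat list \<Rightarrow> nat list \<Rightarrow> nat list \<Rightarrow> bool" where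
  "partitioned_formula L \<phi> x y z \<longleftrightarrow>
     is_formula L \<phi> \<and> distinct (x @ y @ z) \<and> free_vars \<phi> \<subseteq> set (x @ y @ z) \<and> length x = length y"

text \<open>
  \<open>M \<Turnstile> \<phi>(a\<^sub>1,a\<^sub>2;b)\<close>. The assignment is unspecified outside of \<open>x @ y @ z\<close>, where its values do not
  matter by the condition on free variables.
\<close>

definition holds ::
  "('f, 'r, 'a) fo_structure \<Rightarrow> ('f, 'r) fm \<Rightarrow> nat list \<Rightarrow> nat list \<Rightarrow> nat list \<Rightarrow>
    'a list \<Rightarrow> 'a list \<Rightarrow> 'a list \<Rightarrow> bool" where
  "holds M \<phi> x y z a1 a2 b \<longleftrightarrow> sat M (the \<circ> map_of (zip (x @ y @ z) (a1 @ a2 @ b))) \<phi>"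


section \<open>The strong Erdos--Hajnal property\<close>

definition strong_EH :: "(('a \<times> 'a) set \<times> 'a set \<times> 'a set) set \<Rightarrow> bool" where
  "strong_EH G \<longleftrightarrow> (\<exists>\<delta>::real. \<delta> > 0 \<and> (\<forall>(E, V1, V2)\<in>G. \<exists>V1' V2'. V1' \<subseteq> V1 \<and> V2' \<subseteq> V2 \<and>
     real (card V1') \<ge> \<delta> * real (card V1) \<and> real (card V2') \<ge> \<delta> * real (card V2) \<and>
     (V1' \<times> V2' \<subseteq> E \<or> (V1' \<times> V2') \<inter> E = {})))"

definition formula_graphs ::
  "('f, 'r, 'a) fo_structure \<Rightarrow> ('f, 'r) fm \<Rightarrow> nat list \<Rightarrow> nat list \<Rightarrow> nat list \<Rightarrow>
    (('a list \<times> 'a list) set \<times> 'a list set \<times> 'a list set) set" where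
  "formula_graphs M \<phi> x y z = {(E, V1, V2).
     finite V1 \<and> finite V2 \<and> V1 \<subseteq> nlists (length x) (univ M) \<and> V2 \<subseteq> nlists (length x) (univ M) \<and>
     (\<exists>b\<in>nlists (length z) (univ M). E = {(a1, a2) \<in> V1 \<times> V2. holds M \<phi> x y z a1 a2 b})}"

definition structure_strong_EH :: "('f, 'r) language \<Rightarrow> ('f, 'r, 'a) fo_structure \<Rightarrow> bool" where
  "structure_strong_EH L M \<longleftrightarrow>
     (\<forall>\<phi> x y z. partitioned_formula L \<phi> x y z \<longrightarrow> strong_EH (formula_graphs M \<phi> x y z))"


section \<open>Indiscernible sequences and Ramsey numbers\<close>

definition indiscernible :: "('a \<times> 'a) set \<Rightarrow> 'a list \<Rightarrow> bool" where
  "indiscernible E s \<longleftrightarrow>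
     (\<forall>i j. i < j \<and> j < length s \<longrightarrow> (s ! i, s ! j) \<in> E) \<or>
     (\<forall>i j. i < j \<and> j < length s \<longrightarrow> (s ! i, s ! j) \<notin> E)"

definition ramsey_number :: "'a set \<Rightarrow> ('a \<times> 'a) set \<Rightarrow> nat \<Rightarrow> nat" where
  "ramsey_number X E n =
     (LEAST N. \<forall>s\<in>nlists N X. \<exists>t. subseq t s \<and> length t = n \<and> indiscernible E t)"

definition formula_rel ::
  "('f, 'r, 'a) fo_structure \<Rightarrow> ('f, 'r) fm \<Rightarrow> nat list \<Rightarrow> nat list \<Rightarrow> nat list \<Rightarrow> 'a list \<Rightarrow>
    ('a list \<times> 'a list) set" where
  "formula_rel M \<phi> x y z b =
     {(a1, a2) \<in> nlists (length x) (univ M) \<times> nlists (length x) (univ M). holds M \<phi> x y z a1 a2 b}"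

definition formula_ramsey ::
  "('f, 'r, 'a) fo_structure \<Rightarrow> ('f, 'r) fm \<Rightarrow> nat list \<Rightarrow> nat list \<Rightarrow> nat list \<Rightarrow> nat \<Rightarrow> nat" where
  "formula_ramsey M \<phi> x y z n =
     Max {ramsey_number (nlists (length x) (univ M)) (formula_rel M \<phi> x y z b) n | b.
            b \<in> nlists (length z) (univ M)}"

text \<open>
  By Ramsey's theorem the \<open>LEAST\<close> in \<open>ramsey_number\<close> exists, and the set whose \<open>Max\<close> is taken in
  \<open>formula_ramsey\<close> is finite; it is nonempty since structures are nonempty.
\<close>

lemma ramsey_sequences:
  "\<exists>N. \<forall>(E::('a \<times> 'a) set) s. length s = N \<longrightarrow>
     (\<exists>t. subseq t s \<and> length t = n \<and> indiscernible E t)"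
proof -
  obtain N where N: "\<And>(V::nat set) F. finite V \<Longrightarrow> card V \<ge> N \<Longrightarrow>
      \<exists>R \<subseteq> V. card R = n \<and> clique R F \<or> card R = n \<and> indep R F"
    using ramsey2[of n n] by blast
  have "\<exists>t. subseq t s \<and> length t = n \<and> indiscernible E t"
    if len: "length s = N" for E :: "('a \<times> 'a) set" and s
  proof -
    define F where "F = {{i, j} | i j. i < j \<and> (s ! i, s ! j) \<in> E}"
    obtain R where R: "R \<subseteq> {0..<N}" "card R = n" "clique R F \<or> indep R F"
      using N[of "{0..<N}" F] by auto
    define u where "u = filter (\<lambda>i. i \<in> R) [0..<N]"
    have set_u: "set u = R"
      using R(1) by (auto simp: u_def)
    have len_u: "length u = n"
      using distinct_card[of u] set_u R(2) by (simp add: u_def)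
    have "sorted_wrt (<) u"
      unfolding u_def by (simp add: sorted_wrt_filter)
    then have u_less: "u ! i < u ! j" if "i < j" "j < length u" for i j
      using that sorted_wrt_nth_less by blast
    have F_iff: "{i, j} \<in> F \<longleftrightarrow> (s ! i, s ! j) \<in> E" if "i < j" for i j
      using that by (auto simp: F_def doubleton_eq_iff)
    define t where "t = map ((!) s) u"
    have "subseq t (map ((!) s) [0..<N])"
      unfolding t_def u_def by (intro subseq_map subseq_filter_left)
    then have "subseq t s"
      using len map_nth[of s] by simp
    moreover have "length t = n"
      by (simp add: t_def len_u)
    moreover have "indiscernible E t"
    proof -
      have *: "((t ! i, t ! j) \<in> E) = ({u ! i, u ! j} \<in> F)"
          and **: "u ! i \<in> R" "u ! j \<in> R" "u ! i \<noteq> u ! j"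
        if "i < j" "j < length t" for i j
        using that u_less[of i j] F_iff[of "u ! i" "u ! j"] nth_mem[of i u] nth_mem[of j u] set_u
        by (auto simp: t_def)
      show ?thesis
        using R(3)
      proof
        assume "clique R F"
        then have "(t ! i, t ! j) \<in> E" if "i < j" "j < length t" for i j
          using *[OF that] **[OF that] by (simp add: clique_def)
        then show ?thesis by (simp add: indiscernible_def)
      next
        assume "indep R F"
        then have "(t ! i, t ! j) \<notin> E" if "i < j" "j < length t" for i j
          using *[OF that] **[OF that] by (simp add: indep_def)
        then show ?thesis by (simp add: indiscernible_def)
      qed
    qed
    ultimately show ?thesis by blast
  qed
  then show ?thesis by blast
qed

lemma ramsey_number_property:
  fixes X :: "'a set"
  shows "\<forall>s\<in>nlists (ramsey_number X E n) X. \<exists>t. subseq t s \<and> length t = n \<and> indiscernible E t"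
  unfolding ramsey_number_def
proof (rule LeastI_ex)
  show "\<exists>N. \<forall>s\<in>nlists N X. \<exists>t. subseq t s \<and> length t = n \<and> indiscernible E t"
  proof -
    obtain N where "\<And>(E::('a \<times> 'a) set) s. length s = N \<Longrightarrow>
        \<exists>t. subseq t s \<and> length t = n \<and> indiscernible E t"
      using ramsey_sequences[of n] by blast
    then have "\<forall>s\<in>nlists N X. \<exists>t. subseq t s \<and> length t = n \<and> indiscernible E t"
      using nlistsE_length by blast
    then show ?thesis ..
  qed
qed

lemma finite_ramsey_numbers:
  fixes X :: "'a set"
  shows "finite {ramsey_number X (E b) n | b. b \<in> B}"
proof -
  obtain N where N: "\<And>(E::('a \<times> 'a) set) s. length s = N \<Longrightarrow>
      \<exists>t. subseq t s \<and> length t = n \<and> indiscernible E t"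
    using ramsey_sequences[of n] by blast
  have "ramsey_number X E' n \<le> N" for E'
    unfolding ramsey_number_def
  proof (rule Least_le, rule ballI)
    fix s assume "s \<in> nlists N X"
    then have "length s = N" by (rule nlistsE_length)
    then show "\<exists>t. subseq t s \<and> length t = n \<and> indiscernible E' t" by (rule N)
  qed
  then have "{ramsey_number X (E b) n | b. b \<in> B} \<subseteq> {..N}"
    by auto
  then show ?thesis
    using finite_subset by blast
qed

lemma nlists_univ_nonempty:
  assumes "is_structure L M"
  shows "nlists k (univ M) \<noteq> {}"
proof -
  have "univ M \<noteq> {}"
    using assms by (simp add: is_structure_def)
  then obtain a where "a \<in> univ M"
    by blast
  then have "replicate k a \<in> nlists k (univ M)"
    by (rule nlists_replicateI)
  then show ?thesis by blast
qed

end

theory Submission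
  imports Defs
begin

text \<open>
  The proof converts the linear-size homogeneous pairs of the strong Erdos--Hajnal property into
  homogeneous subsequences by a halving argument. Fix a relation \<open>P\<close> defined by the formula with
  some parameters and call a sequence a chain for \<open>P\<close> if \<open>P\<close> holds between each entry and each
  later one, that is, if it satisfies \<open>sorted_wrt P\<close>. The quantity to follow is the product of the length of the longest chain
  for \<open>P\<close> and that of the longest chain for the negation of \<open>P\<close>. Cut a sequence of distinct elements
  into two halves and apply strong Erdos--Hajnal to their entries: this leaves a constant
  proportion of each half such that, say, \<open>P\<close> holds between the two remainders. Chains for \<open>P\<close> in
  the two remainders then concatenate, whereas for the negation the longer of the two chains is
  kept. Hence the products add up (lemma \<open>concatenate_chains\<close>), so that multiplying the length of
  the sequence by a constant doubles the product, and sequences of length \<open>C ^ p\<close> have product at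
  least \<open>2 ^ p\<close> (lemma \<open>chains_with_large_product\<close>). The product is thus at least a fixed positive
  power of the length of the sequence. Once it reaches \<open>n\<^sup>2\<close>, one of the two chains has length at
  least \<open>n\<close>.

  Since strong Erdos--Hajnal concerns sets, repeated entries need separate treatment: an entry
  that occurs \<open>n\<close> times gives a constant subsequence, which is indiscernible, and otherwise
  removing duplicates shortens the sequence by a factor of at most \<open>n\<close>
  (lemma \<open>frequent_or_many_values\<close>). All bounds depend only on the constant \<open>\<delta>\<close> of the formula and
  not on its parameters, so they apply to the maximum over all parameters.
\<close>

section \<open>Chains in sequences of distinct elements\<close>

lemma sorted_wrt_imp_indiscernible:
  assumes "sorted_wrt (\<lambda>a b. (a, b) \<in> E) t \<or> sorted_wrt (\<lambda>a b. (a, b) \<notin> E) t"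
  shows "indiscernible E t"
  using assms unfolding indiscernible_def sorted_wrt_iff_nth_less by blast

text \<open>
  The relations \<open>P\<close> and \<open>Q\<close> are kept separate because the lemma is applied both to a relation and
  its negation and to the same two in exchanged roles. The product behaves additively since
  \<open>(a\<^sub>1 + a\<^sub>2) * max b\<^sub>1 b\<^sub>2 \<ge> a\<^sub>1 * b\<^sub>1 + a\<^sub>2 * b\<^sub>2\<close>.
\<close>

lemma concatenate_chains:
  assumes t: "subseq t1 s1" "subseq t2 s2" "sorted_wrt P t1" "sorted_wrt P t2"
    and u: "subseq u1 s1" "subseq u2 s2" "sorted_wrt Q u1" "sorted_wrt Q u2"
    and across: "\<And>a b. a \<in> set s1 \<Longrightarrow> b \<in> set s2 \<Longrightarrow> P a b"
    and len: "length t1 * length u1 \<ge> k" "length t2 * length u2 \<ge> k"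
  obtains t u where "subseq t (s1 @ s2)" "subseq u (s1 @ s2)" "sorted_wrt P t" "sorted_wrt Q u"
    "length t * length u \<ge> 2 * k"
proof -
  define u where "u = (if length u1 \<le> length u2 then u2 else u1)"
  have "set t1 \<subseteq> set s1" "set t2 \<subseteq> set s2"
    using t(1,2) subseq_order.order_trans by (auto dest: list_emb_set)
  then have "sorted_wrt P (t1 @ t2)"
    using t(3,4) across by (auto simp: sorted_wrt_append)
  moreover have "subseq (t1 @ t2) (s1 @ s2)"
    using t(1,2) by (rule list_emb_append_mono)
  moreover have "subseq u (s1 @ s2)" "sorted_wrt Q u"
    using u list_emb_append_mono[OF u(1), of "[]" s2] by (auto simp: u_def)
  moreover have "2 * k \<le> length (t1 @ t2) * length u"
  proof -
    have "length u1 \<le> length u" "length u2 \<le> length u"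
      by (auto simp: u_def)
    then have "k \<le> length t1 * length u" "k \<le> length t2 * length u"
      using len le_trans mult_le_mono2 by metis+
    then show ?thesis
      by (simp add: add_mult_distrib)
  qed
  ultimately show thesis
    using that by blast
qed

text \<open>
  This is the strong Erdos--Hajnal property of a single relation on the finite subsets of \<open>X\<close>, with
  \<open>\<delta> = 1 / D\<close> and phrased without division: two sets of size at least \<open>D * k\<close> contain a
  homogeneous pair of sets of size at least \<open>k\<close>.
\<close>

definition homogeneous_pairs :: "nat \<Rightarrow> 'a set \<Rightarrow> ('a \<times> 'a) set \<Rightarrow> bool" where
  "homogeneous_pairs D X E \<longleftrightarrow> (\<forall>V1 V2 k. finite V1 \<longrightarrow> finite V2 \<longrightarrow> V1 \<subseteq> X \<longrightarrow> V2 \<subseteq> X \<longrightarrow>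
     card V1 \<ge> D * k \<longrightarrow> card V2 \<ge> D * k \<longrightarrow>
     (\<exists>W1 W2. W1 \<subseteq> V1 \<and> W2 \<subseteq> V2 \<and> card W1 \<ge> k \<and> card W2 \<ge> k \<and>
       ((\<forall>a\<in>W1. \<forall>b\<in>W2. (a, b) \<in> E) \<or> (\<forall>a\<in>W1. \<forall>b\<in>W2. (a, b) \<notin> E))))"

lemma homogeneous_pairsE:
  assumes "homogeneous_pairs D X E" "finite V1" "finite V2" "V1 \<subseteq> X" "V2 \<subseteq> X"
    "card V1 \<ge> D * k" "card V2 \<ge> D * k"
  obtains W1 W2 where "W1 \<subseteq> V1" "W2 \<subseteq> V2" "card W1 \<ge> k" "card W2 \<ge> k"
    "(\<forall>a\<in>W1. \<forall>b\<in>W2. (a, b) \<in> E) \<or> (\<forall>a\<in>W1. \<forall>b\<in>W2. (a, b) \<notin> E)"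
  using assms(1)[unfolded homogeneous_pairs_def, rule_format, OF assms(2-7)] by blast

text \<open>
  Each step of the induction costs a factor \<open>2\<close> for halving the sequence and a factor \<open>D\<close> for
  passing to a homogeneous pair, and it doubles the product. Distinctness turns lengths of
  sequences into cardinalities of sets. Because the pair comes from the two halves, all entries
  kept from the first half precede those from the second, so that homogeneity in one direction is
  enough for a relation that is not symmetric.
\<close>

lemma chains_with_large_product:
  fixes E :: "('a \<times> 'a) set"
  assumes pairs: "homogeneous_pairs D X E"
  shows "distinct s \<Longrightarrow> set s \<subseteq> X \<Longrightarrow> length s \<ge> (2 * D) ^ p \<Longrightarrow>
    \<exists>t u. subseq t s \<and> subseq u s \<and> sorted_wrt (\<lambda>a b. (a, b) \<in> E) t \<and>
      sorted_wrt (\<lambda>a b. (a, b) \<notin> E) u \<and> length t * length u \<ge> 2 ^ p"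
proof (induction p arbitrary: s)
  case 0
  then obtain a s' where "s = a # s'"
    by (cases s) auto
  then have "subseq [a] s" "length [a] * length [a] \<ge> 2 ^ 0"
    by auto
  moreover have "sorted_wrt (\<lambda>a b. (a, b) \<in> E) [a]" "sorted_wrt (\<lambda>a b. (a, b) \<notin> E) [a]"
    by auto
  ultimately show ?case
    by blast
next
  case (Suc p)
  define m where "m = D * (2 * D) ^ p"
  have len: "length s \<ge> 2 * m"
    using Suc.prems(3) by (simp add: m_def ac_simps)
  have "card (set (take m s)) \<ge> D * (2 * D) ^ p" "card (set (drop m s)) \<ge> D * (2 * D) ^ p"
    using len Suc.prems(1) by (auto simp: distinct_card m_def)
  moreover have "set (take m s) \<subseteq> X" "set (drop m s) \<subseteq> X"
    using Suc.prems(2) by (auto dest: in_set_takeD in_set_dropD)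
  ultimately obtain W1 W2 where W: "W1 \<subseteq> set (take m s)" "W2 \<subseteq> set (drop m s)"
      "card W1 \<ge> (2 * D) ^ p" "card W2 \<ge> (2 * D) ^ p"
      "(\<forall>a\<in>W1. \<forall>b\<in>W2. (a, b) \<in> E) \<or> (\<forall>a\<in>W1. \<forall>b\<in>W2. (a, b) \<notin> E)"
    using homogeneous_pairsE[OF pairs, of "set (take m s)" "set (drop m s)" "(2 * D) ^ p"]
    by blast
  define s1 s2 where "s1 = filter (\<lambda>a. a \<in> W1) (take m s)" "s2 = filter (\<lambda>a. a \<in> W2) (drop m s)"
  have set_s: "set s1 = W1" "set s2 = W2"
    using W(1,2) by (auto simp: s1_s2_def)
  have dist: "distinct s1" "distinct s2"
    using Suc.prems(1) by (auto simp: s1_s2_def)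
  have sub: "subseq (s1 @ s2) s"
    using list_emb_append_mono[of "(=)" s1 "take m s" s2 "drop m s"]
    by (simp add: s1_s2_def)
  have lens: "length s1 \<ge> (2 * D) ^ p" "length s2 \<ge> (2 * D) ^ p"
    using W(3,4) set_s dist distinct_card by metis+
  have inX: "set s1 \<subseteq> X" "set s2 \<subseteq> X"
    using set_s W(1,2) \<open>set (take m s) \<subseteq> X\<close> \<open>set (drop m s) \<subseteq> X\<close> by auto
  obtain t1 u1 where 1: "subseq t1 s1" "subseq u1 s1" "sorted_wrt (\<lambda>a b. (a, b) \<in> E) t1"
      "sorted_wrt (\<lambda>a b. (a, b) \<notin> E) u1" "length t1 * length u1 \<ge> 2 ^ p"
    using Suc.IH[OF dist(1) inX(1) lens(1)] by blast
  obtain t2 u2 where 2: "subseq t2 s2" "subseq u2 s2" "sorted_wrt (\<lambda>a b. (a, b) \<in> E) t2"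
      "sorted_wrt (\<lambda>a b. (a, b) \<notin> E) u2" "length t2 * length u2 \<ge> 2 ^ p"
    using Suc.IH[OF dist(2) inX(2) lens(2)] by blast
  obtain t u where "subseq t (s1 @ s2)" "subseq u (s1 @ s2)" "sorted_wrt (\<lambda>a b. (a, b) \<in> E) t"
      "sorted_wrt (\<lambda>a b. (a, b) \<notin> E) u" "length t * length u \<ge> 2 * 2 ^ p"
    using W(5)
  proof
    assume "\<forall>a\<in>W1. \<forall>b\<in>W2. (a, b) \<in> E"
    then show thesis
      using concatenate_chains[of t1 s1 t2 s2 "\<lambda>a b. (a, b) \<in> E" u1 u2
          "\<lambda>a b. (a, b) \<notin> E" "2 ^ p"] 1 2 set_s that
      by blast
  next
    assume "\<forall>a\<in>W1. \<forall>b\<in>W2. (a, b) \<notin> E"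
    moreover have "length u1 * length t1 \<ge> 2 ^ p" "length u2 * length t2 \<ge> 2 ^ p"
      using 1(5) 2(5) by (simp_all add: mult.commute)
    ultimately obtain u t where "subseq u (s1 @ s2)" "subseq t (s1 @ s2)"
        "sorted_wrt (\<lambda>a b. (a, b) \<notin> E) u" "sorted_wrt (\<lambda>a b. (a, b) \<in> E) t"
        "length u * length t \<ge> 2 * 2 ^ p"
      using concatenate_chains[of u1 s1 u2 s2 "\<lambda>a b. (a, b) \<notin> E" t1 t2
          "\<lambda>a b. (a, b) \<in> E" "2 ^ p"] 1 2 set_s by blast
    then show thesis
      using that[of t u] mult.commute[of "length u" "length t"] by metis
  qed
  moreover from this have "subseq t s" "subseq u s"
    using sub subseq_order.order_trans by blast+
  ultimately show ?case
    unfolding power_Suc by blast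
qed


section \<open>Polynomial Ramsey bounds\<close>

lemma subseq_remdups: "subseq (remdups s) s"
  by (induction s) auto

lemma frequent_or_many_values:
  fixes s :: "'a list"
  assumes "length s \<ge> n * k" "n > 0"
  shows "(\<exists>a. subseq (replicate n a) s) \<or> card (set s) \<ge> k"
proof (rule disjCI)
  assume few: "\<not> card (set s) \<ge> k"
  have "\<exists>a. count_list s a \<ge> n"
  proof (rule ccontr)
    assume "\<not> ?thesis"
    then have "count_list s a \<le> n" for a
      by (meson nat_le_linear)
    then have "length s \<le> card (set s) * n"
      using sum_bounded_above[of "set s" "count_list s" n] sum_count_set[of s "set s"] by simp
    also have "\<dots> < k * n"
      using few assms(2) by simp
    finally show False
      using assms(1) by (simp add: mult.commute)
  qed
  then obtain a where a: "count_list s a \<ge> n" ..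
  have "filter ((=) a) s = replicate (count_list s a) a"
    by (induction s) auto
  then have "subseq (replicate (count_list s a) a) s"
    by (metis subseq_filter_left)
  moreover have "subseq (replicate n a) (replicate (count_list s a) a)"
    using a take_is_prefix[of n "replicate (count_list s a) a"] prefix_imp_subseq
    by (metis min.absorb1 take_replicate)
  ultimately show "\<exists>a. subseq (replicate n a) s"
    using subseq_order.order_trans by blast
qed

lemma indiscernible_in_long_distinct_sequence:
  fixes E :: "('a \<times> 'a) set"
  assumes pairs: "homogeneous_pairs D X E"
    and s: "distinct s" "set s \<subseteq> X" "length s \<ge> (2 * D) ^ p" and n: "n\<^sup>2 \<le> 2 ^ p"
  obtains t where "subseq t s" "length t = n" "indiscernible E t"
proof -
  obtain t u where tu: "subseq t s" "subseq u s" "sorted_wrt (\<lambda>a b. (a, b) \<in> E) t"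
      "sorted_wrt (\<lambda>a b. (a, b) \<notin> E) u" "length t * length u \<ge> 2 ^ p"
    using chains_with_large_product[OF pairs s] by blast
  have "length t \<ge> n \<or> length u \<ge> n"
  proof (rule ccontr)
    assume "\<not> ?thesis"
    then have "length t * length u < n * n"
      by (intro mult_strict_mono) auto
    then show False
      using tu(5) n by (simp add: power2_eq_square)
  qed
  then obtain v where v: "subseq v s" "length v \<ge> n"
      "sorted_wrt (\<lambda>a b. (a, b) \<in> E) v \<or> sorted_wrt (\<lambda>a b. (a, b) \<notin> E) v"
    using tu by blast
  have "subseq (take n v) s"
    using v(1) take_is_prefix prefix_imp_subseq subseq_order.order_trans by blast
  moreover have "indiscernible E (take n v)"
    using v(3) by (intro sorted_wrt_imp_indiscernible) (auto intro: sorted_wrt_take)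
  ultimately show thesis
    using that v(2) by simp
qed

text \<open>
  The constant of the homogeneous pairs is taken to be a power of two, and the target \<open>n\<close> is rounded up to a power of two
  \<open>2 ^ r \<le> n\<^sup>2\<close>. A distinct sequence of length \<open>(2 * 2 ^ q) ^ (2 * r) = (2 ^ r) ^ (2 * (q + 1))\<close>,
  which is at most \<open>n ^ (4 * (q + 1))\<close>, then contains an indiscernible sequence of length \<open>n\<close>. The
  further factor \<open>n\<close> in the bound accounts for repetitions.
\<close>

lemma ramsey_number_polynomial_bound:
  fixes E :: "('a \<times> 'a) set"
  assumes pairs: "homogeneous_pairs (2 ^ q) X E"
    and n: "n \<ge> 2"
  shows "ramsey_number X E n \<le> n ^ (4 * q + 5)"
  unfolding ramsey_number_def
proof (rule Least_le, rule ballI)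
  fix s assume s: "s \<in> nlists (n ^ (4 * q + 5)) X"
  have "length s = n ^ Suc (4 * (q + 1))" and set_s: "set s \<subseteq> X"
    using s unfolding nlists_def by (simp_all add: eval_nat_numeral)
  then have len_s: "length s = n * n ^ (4 * (q + 1))"
    by (simp only: power_Suc)
  show "\<exists>t. subseq t s \<and> length t = n \<and> indiscernible E t"
  proof (cases "\<exists>a. subseq (replicate n a) s")
    case True
    moreover have "indiscernible E (replicate n a)" for a
      by (auto simp: indiscernible_def)
    ultimately show ?thesis
      by (metis length_replicate)
  next
    case False
    then have many: "length (remdups s) \<ge> n ^ (4 * (q + 1))"
      using frequent_or_many_values[of n "n ^ (4 * (q + 1))" s] len_s n
      by (simp add: length_remdups_card_conv)
    obtain r' where "2 ^ r' \<le> n" "n < 2 ^ (r' + 1)"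
      using ex_power_ivl1[of 2 n] n by auto
    then obtain r :: nat where r: "n \<le> 2 ^ r" "2 ^ r \<le> 2 * n"
      by (metis less_imp_le_nat mult_le_mono2 power_Suc Suc_eq_plus1)
    have "2 * n \<le> n\<^sup>2"
      using n by (simp add: power2_eq_square)
    with r(2) have "2 ^ r \<le> n\<^sup>2"
      by linarith
    have "(2 * 2 ^ q :: nat) ^ (2 * r) = (2 ^ r) ^ (2 * (q + 1))"
      by (simp flip: power_Suc power_mult add: ac_simps)
    also have "\<dots> \<le> (n\<^sup>2) ^ (2 * (q + 1))"
      using \<open>2 ^ r \<le> n\<^sup>2\<close> by (rule power_mono) simp
    also have "\<dots> = n ^ (4 * (q + 1))"
      by (simp only: power_mult[symmetric] mult.assoc[symmetric]) simp
    also note many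
    finally have long: "(2 * 2 ^ q) ^ (2 * r) \<le> length (remdups s)" .
    have square: "n\<^sup>2 \<le> 2 ^ (2 * r)"
      using power_mono[OF r(1), of 2] by (simp only: power_mult[symmetric] mult.commute)
    have "distinct (remdups s)" "set (remdups s) \<subseteq> X"
      using set_s by simp_all
    from indiscernible_in_long_distinct_sequence[OF pairs this long square]
    obtain t where "subseq t (remdups s)" "length t = n" "indiscernible E t" .
    then show ?thesis
      using subseq_remdups subseq_order.order_trans by blast
  qed
qed


section \<open>Formulas with the strong Erdos--Hajnal property\<close>

text \<open>
  The exponent \<open>q\<close> depends only on \<open>\<delta>\<close>, so it is the same for all parameters \<open>b\<close> of the formula.
\<close>

lemma strong_EH_formula_pairs:
  fixes M :: "('f, 'r, 'a) fo_structure"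
  assumes "strong_EH (formula_graphs M \<phi> x y z)"
  obtains q where "\<And>b. b \<in> nlists (length z) (univ M) \<Longrightarrow>
    homogeneous_pairs (2 ^ q) (nlists (length x) (univ M)) (formula_rel M \<phi> x y z b)"
proof -
  obtain \<delta> :: real where \<delta>: "\<delta> > 0" and
    EH: "\<forall>(E, V1, V2)\<in>formula_graphs M \<phi> x y z. \<exists>V1' V2'. V1' \<subseteq> V1 \<and> V2' \<subseteq> V2 \<and>
      real (card V1') \<ge> \<delta> * real (card V1) \<and> real (card V2') \<ge> \<delta> * real (card V2) \<and>
      (V1' \<times> V2' \<subseteq> E \<or> (V1' \<times> V2') \<inter> E = {})"
    using assms unfolding strong_EH_def by blast
  obtain q where "1 / \<delta> < 2 ^ q"
    using real_arch_pow[of 2 "1 / \<delta>"] by auto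
  then have q: "1 \<le> \<delta> * 2 ^ q"
    using \<delta> by (simp add: field_simps)
  have scale: "k \<le> w" if "\<delta> * real v \<le> real w" "2 ^ q * k \<le> v" for k v w
  proof -
    have "real k \<le> \<delta> * 2 ^ q * real k"
      using q mult_right_mono[of 1 "\<delta> * 2 ^ q" "real k"] by simp
    also have "\<dots> = \<delta> * real (2 ^ q * k)"
      by simp
    also have "\<dots> \<le> \<delta> * real v"
      using that(2) \<delta> by (intro mult_left_mono) (auto simp only: of_nat_le_iff)
    finally show ?thesis
      using that(1) by linarith
  qed
  show thesis
  proof (rule that[of q], unfold homogeneous_pairs_def, intro allI impI)
    fix b V1 V2 k
    assume b: "b \<in> nlists (length z) (univ M)" and fin: "finite V1" "finite V2"
      and V: "V1 \<subseteq> nlists (length x) (univ M)" "V2 \<subseteq> nlists (length x) (univ M)"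
      and k: "card V1 \<ge> 2 ^ q * k" "card V2 \<ge> 2 ^ q * k"
    define E where "E = {(a1, a2) \<in> V1 \<times> V2. holds M \<phi> x y z a1 a2 b}"
    have "(E, V1, V2) \<in> formula_graphs M \<phi> x y z"
      using b fin V by (auto simp: formula_graphs_def E_def)
    from bspec[OF EH this] obtain W1 W2 where W: "W1 \<subseteq> V1" "W2 \<subseteq> V2"
        "real (card W1) \<ge> \<delta> * real (card V1)" "real (card W2) \<ge> \<delta> * real (card V2)"
        "W1 \<times> W2 \<subseteq> E \<or> (W1 \<times> W2) \<inter> E = {}"
      by auto
    have E_iff: "(a1, a2) \<in> E \<longleftrightarrow> (a1, a2) \<in> formula_rel M \<phi> x y z b"
      if "a1 \<in> W1" "a2 \<in> W2" for a1 a2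
      using that W(1,2) V by (auto simp: E_def formula_rel_def)
    have "(\<forall>a1\<in>W1. \<forall>a2\<in>W2. (a1, a2) \<in> formula_rel M \<phi> x y z b) \<or>
        (\<forall>a1\<in>W1. \<forall>a2\<in>W2. (a1, a2) \<notin> formula_rel M \<phi> x y z b)"
      using W(5) E_iff by blast
    then show "\<exists>W1 W2. W1 \<subseteq> V1 \<and> W2 \<subseteq> V2 \<and> card W1 \<ge> k \<and> card W2 \<ge> k \<and>
        ((\<forall>a1\<in>W1. \<forall>a2\<in>W2. (a1, a2) \<in> formula_rel M \<phi> x y z b) \<or>
         (\<forall>a1\<in>W1. \<forall>a2\<in>W2. (a1, a2) \<notin> formula_rel M \<phi> x y z b))"
      using W(1,2) scale[OF W(3) k(1)] scale[OF W(4) k(2)] by blast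
  qed
qed

theorem proposition6p9:
  fixes L :: "('f, 'r) language" and M :: "('f, 'r, 'a) fo_structure"
  assumes "is_structure L M" and "structure_strong_EH L M"
  shows "\<forall>\<phi> x y z. partitioned_formula L \<phi> x y z \<longrightarrow>
    (\<exists>c::real. \<forall>\<^sub>F n in sequentially. real (formula_ramsey M \<phi> x y z n) \<le> real n powr c)"
proof (intro allI impI)
  fix \<phi> x y z assume "partitioned_formula L \<phi> x y z"
  then have "strong_EH (formula_graphs M \<phi> x y z)"
    using assms(2) by (simp add: structure_strong_EH_def)
  from strong_EH_formula_pairs[OF this] obtain q where q: "\<And>b. b \<in> nlists (length z) (univ M) \<Longrightarrow>
      homogeneous_pairs (2 ^ q) (nlists (length x) (univ M)) (formula_rel M \<phi> x y z b)"
    by blast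
  have "real (formula_ramsey M \<phi> x y z n) \<le> real n powr real (4 * q + 5)" if n: "n \<ge> 2" for n
  proof -
    have "ramsey_number (nlists (length x) (univ M)) (formula_rel M \<phi> x y z b) n \<le> n ^ (4 * q + 5)"
      if "b \<in> nlists (length z) (univ M)" for b
      using ramsey_number_polynomial_bound[OF q[OF that] n] .
    then have "formula_ramsey M \<phi> x y z n \<le> n ^ (4 * q + 5)"
      unfolding formula_ramsey_def
      using nlists_univ_nonempty[OF assms(1), of "length z"]
      by (intro Max.boundedI finite_ramsey_numbers) auto
    then have "real (formula_ramsey M \<phi> x y z n) \<le> real n ^ (4 * q + 5)"
      by (metis of_nat_le_iff of_nat_power)
    then show ?thesis
      using n by (simp only: powr_realpow)
  qed
  then show "\<exists>c::real. \<forall>\<^sub>F n in sequentially. real (formula_ramsey M \<phi> x y z n) \<le> real n powr c"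
    by (blast intro: eventually_sequentiallyI)
qed

end
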